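(* For an integer $n\geq 10$, Left will win the cycle position $C_n$ in the Mutual Failures Variant regardless of which player moves first.
   Context: The Mutual Failures Variant of the Mixed Deletion Game is a partisan combinatorial game played on a finite simple undirected graph by two players, Left and Right, who alternate turns. On her turn Left deletes one vertex together with all its incident edges; on his turn Right deletes one edge. A deletion that would create an isolated vertex ends the game and the player who made it loses (so such deletions are effectively unavailable). In addition, the Mutual Failures Variant imposes the condition that in any graph position Right has no available move if and only if Left has no available move. $C_n$ denotes the game position on the cycle graph with $n$ vertices. *)

theory Defs
  imports Main
begin

(* A finite simple undirected graph is a pair (V, E) of a finite vertex set and a set of
   two-element subsets of V. *)
type_synonym 'a graph = "'a set \<times> 'a set set"

definition simple_graph :: "'a graph \<Rightarrow> bool" where
  "simple_graph G \<longleftrightarrow> finite (fst G) \<and> (\<forall>e\<in>snd G. e \<subseteq> fst G \<and> card e = 2)"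

definition isolated :: "'a graph \<Rightarrow> 'a \<Rightarrow> bool" where
  "isolated G v \<longleftrightarrow> v \<in> fst G \<and> (\<forall>e\<in>snd G. v \<notin> e)"

definition delete_vertex :: "'a graph \<Rightarrow> 'a \<Rightarrow> 'a graph" where
  "delete_vertex G v = (fst G - {v}, {e \<in> snd G. v \<notin> e})"

definition delete_edge :: "'a graph \<Rightarrow> 'a set \<Rightarrow> 'a graph" where
  "delete_edge G e = (fst G, snd G - {e})"

datatype player = Left | Right

fun opponent :: "player \<Rightarrow> player" where
  "opponent Left = Right"
| "opponent Right = Left"

fun deletion :: "player \<Rightarrow> 'a graph \<Rightarrow> 'a graph \<Rightarrow> bool" where
  "deletion Left G H \<longleftrightarrow> (\<exists>v\<in>fst G. H = delete_vertex G v)"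
| "deletion Right G H \<longleftrightarrow> (\<exists>e\<in>snd G. H = delete_edge G e)"

definition creates_isolated :: "'a graph \<Rightarrow> 'a graph \<Rightarrow> bool" where
  "creates_isolated G H \<longleftrightarrow> (\<exists>v. isolated H v \<and> \<not> isolated G v)"

definition safe_deletion :: "player \<Rightarrow> 'a graph \<Rightarrow> 'a graph \<Rightarrow> bool" where
  "safe_deletion p G H \<longleftrightarrow> deletion p G H \<and> \<not> creates_isolated G H"

(* Mutual failures: if one of the players has no safe deletion in the graph G (taken as a
   whole, connected or not), then G offers no available move to the other player either. *)
definition available_move :: "player \<Rightarrow> 'a graph \<Rightarrow> 'a graph \<Rightarrow> bool" where
  "available_move p G H \<longleftrightarrow> safe_deletion p G H \<and> (\<exists>K. safe_deletion (opponent p) G K)"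

lemma mutual_failures:
  "(\<nexists>H. available_move Right G H) \<longleftrightarrow> (\<nexists>H. available_move Left G H)"
  by (auto simp: available_move_def)

(* wins q p G: player q can force a win from position G when player p is to move. A player to
   move without an available move loses: the second rule then holds vacuously for the other
   player, while the first rule cannot apply. *)
inductive wins :: "player \<Rightarrow> player \<Rightarrow> 'a graph \<Rightarrow> bool" for q :: player where
  own_turn: "available_move q G H \<Longrightarrow> wins q (opponent q) H \<Longrightarrow> wins q q G"
| other_turn: "(\<And>H. available_move (opponent q) G H \<Longrightarrow> wins q q H) \<Longrightarrow> wins q (opponent q) G"

(* For n \<ge> 3 this is the cycle graph with vertices 0, ..., n - 1. *)
definition cycle_graph :: "nat \<Rightarrow> nat graph" where
  "cycle_graph n = ({..<n}, {{i, Suc i mod n} | i. i < n})"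

lemma simple_graph_cycle_graph:
  assumes "n \<ge> 3"
  shows "simple_graph (cycle_graph n)"
proof -
  have "i \<noteq> Suc i mod n" if "i < n" for i
    using that assms by (cases "Suc i = n") auto
  then show ?thesis
    using assms by (auto simp: simple_graph_def cycle_graph_def card_insert_if)
qed

lemma simple_graph_available_move:
  "simple_graph G \<Longrightarrow> available_move p G H \<Longrightarrow> simple_graph H"
  by (cases p) (fastforce simp: simple_graph_def available_move_def safe_deletion_def
      delete_vertex_def delete_edge_def)+

end

theory Submission
  imports Defs "HOL-Library.Multiset"
begin

text \<open>Once the cycle has been broken, every position is a disjoint union of paths, described by
  the multiset of their orders. A path of order 2 is inert, and a path of order 3 gives Left
  alone a spare move for as long as some path has order at least 4; the game ends
  when no path of order at least 4 is left. With Left to move, she loses only if the game has ended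
  or the paths of order at least 3 form the multiset \<open>{4, 4}\<close>. With Right to move, Left
  loses only if exactly one path has order at least 4 and that order is at most 6, or if the paths
  of order at least 3 form \<open>{8}\<close>, \<open>{4, 6}\<close> or \<open>{4, 4, 4}\<close>. Since \<open>C\<^sub>n\<close> becomes \<open>P\<^sub>n\<close> after a
  move by Right and \<open>P\<^sub>n\<^sub>-\<^sub>1\<close> after a move by Left, \<open>n \<ge> 10\<close> avoids all exceptions.\<close>

section \<open>Paths as vertex lists\<close>

fun path_edges :: "'a list \<Rightarrow> 'a set set" where
  "path_edges [] = {}"
| "path_edges [x] = {}"
| "path_edges (x # y # zs) = insert {x, y} (path_edges (y # zs))"

lemma path_edges_append:
  "path_edges (xs @ ys) = path_edges xs \<union> path_edges ys \<union>
     (if xs = [] \<or> ys = [] then {} else {{last xs, hd ys}})"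
proof (induction xs rule: path_edges.induct)
  case (2 x)
  then show ?case by (cases ys) auto
qed auto

lemma path_edges_subset: "e \<in> path_edges xs \<Longrightarrow> e \<subseteq> set xs \<and> e \<noteq> {}"
  by (induction xs rule: path_edges.induct) auto

lemma path_edges_cover: "x \<in> set xs \<Longrightarrow> length xs \<noteq> 1 \<Longrightarrow> \<exists>e\<in>path_edges xs. x \<in> e"
proof (induction xs rule: path_edges.induct)
  case (3 x y zs)
  then show ?case by (cases zs) auto
qed auto

text \<open>Turns an edge of a path into a cut point of its list, so that removing the edge leaves
  two lists that are paths again.\<close>

lemma path_edges_split:
  "e \<in> path_edges xs \<Longrightarrow>
   \<exists>as bs. xs = as @ bs \<and> as \<noteq> [] \<and> bs \<noteq> [] \<and> e = {last as, hd bs}"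
proof (induction xs rule: path_edges.induct)
  case (3 x y zs)
  show ?case
  proof (cases "e = {x, y}")
    case True
    then show ?thesis by (intro exI[of _ "[x]"] exI[of _ "y # zs"]) auto
  next
    case False
    then obtain as bs where "y # zs = as @ bs" "as \<noteq> []" "bs \<noteq> []" "e = {last as, hd bs}"
      using 3 by auto
    then show ?thesis by (intro exI[of _ "x # as"] exI[of _ bs]) auto
  qed
qed auto

text \<open>Empty lists are allowed as components, so that deleting an end vertex of a path is also a
  splitting into two paths.\<close>

definition linear_forest :: "'a list list \<Rightarrow> 'a graph \<Rightarrow> bool" where
  "linear_forest ps G \<longleftrightarrow> distinct (concat ps) \<and>
     G = (set (concat ps), \<Union>xs\<in>set ps. path_edges xs)"

text \<open>A relation rather than a function: empty components contribute zeros, so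
  \<open>G\<close> fixes \<open>M\<close> only up to the multiplicity of 0, which the winning
  conditions below ignore.\<close>

definition path_orders :: "nat multiset \<Rightarrow> 'a graph \<Rightarrow> bool" where
  "path_orders M G \<longleftrightarrow> (\<exists>ps. linear_forest ps G \<and> mset (map length ps) = M)"

section \<open>Deletions in disjoint unions of paths\<close>

lemma linear_forest_delete_vertex:
  assumes "linear_forest (ps @ (as @ v # bs) # qs) G"
  shows "linear_forest (ps @ as # bs # qs) (delete_vertex G v)"
proof -
  have d: "v \<notin> set (concat ps)" "v \<notin> set (concat qs)" "v \<notin> set as" "v \<notin> set bs"
    using assms by (auto simp: linear_forest_def)
  have "v \<notin> e" if "xs \<in> set ps \<union> set qs \<union> {as, bs}" "e \<in> path_edges xs" for e xs
    using that d path_edges_subset[OF that(2)] by auto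
  \<comment> \<open>The edges at \<open>v\<close> are collected without describing them, which
    covers end vertices and inner vertices alike; the deletion filters them out.\<close>
  moreover have "path_edges (as @ v # bs) = path_edges as \<union> path_edges bs \<union>
      {e \<in> path_edges (as @ v # bs). v \<in> e}"
    using d by (cases bs) (auto simp: path_edges_append dest: path_edges_subset)
  ultimately have "{e \<in> (\<Union>xs\<in>set (ps @ (as @ v # bs) # qs). path_edges xs). v \<notin> e} =
      (\<Union>xs\<in>set (ps @ as # bs # qs). path_edges xs)"
    by simp blast
  then show ?thesis
    using assms d by (auto simp: linear_forest_def delete_vertex_def)
qed

lemma linear_forest_delete_edge:
  assumes "linear_forest (ps @ (as @ bs) # qs) G" "as \<noteq> []" "bs \<noteq> []"
  shows "linear_forest (ps @ as # bs # qs) (delete_edge G {last as, hd bs})"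
    and "{last as, hd bs} \<in> snd G"
proof -
  have d: "last as \<in> set as" "hd bs \<in> set bs" "set as \<inter> set bs = {}"
    "set as \<inter> set (concat (ps @ qs)) = {}"
    using assms by (auto simp: linear_forest_def)
  \<comment> \<open>The removed edge has one end in each of the two disjoint halves, so no remaining
    list contains both ends.\<close>
  have "{last as, hd bs} \<notin> path_edges xs" if "xs \<in> set ps \<union> set qs \<union> {as, bs}" for xs
    using that d path_edges_subset[of "{last as, hd bs}" xs] by auto
  then have "(\<Union>xs\<in>set (ps @ (as @ bs) # qs). path_edges xs) - {{last as, hd bs}} =
      (\<Union>xs\<in>set (ps @ as # bs # qs). path_edges xs)"
    using assms(2,3) by (simp add: path_edges_append) blast
  then show "linear_forest (ps @ as # bs # qs) (delete_edge G {last as, hd bs})"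
    using assms by (auto simp: linear_forest_def delete_edge_def)
  show "{last as, hd bs} \<in> snd G"
    using assms by (auto simp: linear_forest_def path_edges_append)
qed

lemma path_orders_add_msetE:
  assumes "path_orders (add_mset k N) G"
  obtains ps xs qs where "linear_forest (ps @ xs # qs) G" "length xs = k"
    "mset (map length (ps @ qs)) = N"
proof -
  obtain rs where rs: "linear_forest rs G" "mset (map length rs) = add_mset k N"
    using assms by (auto simp: path_orders_def)
  then have "k \<in> set (map length rs)"
    by (metis set_mset_mset union_single_eq_member)
  then obtain xs where xs: "xs \<in> set rs" "length xs = k"
    by auto
  then obtain ps qs where "rs = ps @ xs # qs"
    by (meson split_list)
  then show thesis
    using rs xs that by auto
qed

text \<open>Left picks her vertex, so existence for prescribed parts suffices; the 1 in
  \<open>a + b + 1\<close> is the deleted vertex.\<close>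

lemma path_orders_delete_vertex:
  assumes "path_orders (add_mset (a + b + 1) N) G"
  obtains v where "v \<in> fst G" "path_orders (add_mset a (add_mset b N)) (delete_vertex G v)"
proof -
  obtain ps xs qs where *: "linear_forest (ps @ xs # qs) G" "length xs = a + b + 1"
    "mset (map length (ps @ qs)) = N"
    using assms by (elim path_orders_add_msetE)
  define as bs where "as = take a xs" and "bs = drop (Suc a) xs"
  have xs: "xs = as @ xs ! a # bs" "length as = a" "length bs = b"
    using *(2) id_take_nth_drop[of a xs] by (auto simp: as_def bs_def)
  have "linear_forest (ps @ as # bs # qs) (delete_vertex G (xs ! a))"
    using * xs linear_forest_delete_vertex by metis
  moreover have "mset (map length (ps @ as # bs # qs)) = add_mset a (add_mset b N)"
    using *(3) xs(2,3) by simp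
  moreover have "xs ! a \<in> fst G"
    using *(1,2) by (simp add: linear_forest_def)
  ultimately show thesis
    using that unfolding path_orders_def by blast
qed

text \<open>Right's edge is arbitrary, so here the parts come from the edge instead of being
  prescribed.\<close>

lemma path_orders_delete_edge:
  assumes "path_orders M G" "e \<in> snd G"
  obtains a b N where "M = add_mset (a + b) N" "a \<ge> 1" "b \<ge> 1"
    "path_orders (add_mset a (add_mset b N)) (delete_edge G e)"
proof -
  obtain rs where rs: "linear_forest rs G" "mset (map length rs) = M"
    using assms by (auto simp: path_orders_def)
  then obtain xs where "xs \<in> set rs" "e \<in> path_edges xs"
    using assms(2) by (auto simp: linear_forest_def)
  then obtain ps qs as bs where *: "rs = ps @ (as @ bs) # qs" "as \<noteq> []" "bs \<noteq> []"
    "e = {last as, hd bs}"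
    by (metis path_edges_split split_list)
  let ?N = "mset (map length (ps @ qs))"
  have "linear_forest (ps @ as # bs # qs) (delete_edge G e)"
    using rs * linear_forest_delete_edge(1) by blast
  moreover have "mset (map length (ps @ as # bs # qs)) =
      add_mset (length as) (add_mset (length bs) ?N)"
    by simp
  ultimately have "path_orders (add_mset (length as) (add_mset (length bs) ?N)) (delete_edge G e)"
    unfolding path_orders_def by blast
  moreover have "M = add_mset (length as + length bs) ?N"
    using rs * by auto
  ultimately show thesis
    using that[of "length as" "length bs" ?N] * by (simp add: Suc_le_eq)
qed

lemma path_orders_edge_exists:
  assumes "path_orders (add_mset (a + b) N) G" "a \<ge> 1" "b \<ge> 1"
  obtains e where "e \<in> snd G" "path_orders (add_mset a (add_mset b N)) (delete_edge G e)"
proof -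
  obtain ps xs qs where *: "linear_forest (ps @ xs # qs) G" "length xs = a + b"
    "mset (map length (ps @ qs)) = N"
    using assms by (elim path_orders_add_msetE)
  define as bs where "as = take a xs" and "bs = drop a xs"
  have xs: "xs = as @ bs" "length as = a" "length bs = b" "as \<noteq> []" "bs \<noteq> []"
    using * assms by (auto simp: as_def bs_def)
  have "linear_forest (ps @ as # bs # qs) (delete_edge G {last as, hd bs})"
    "{last as, hd bs} \<in> snd G"
    using * xs linear_forest_delete_edge by metis+
  moreover have "mset (map length (ps @ as # bs # qs)) = add_mset a (add_mset b N)"
    using * xs by auto
  ultimately show thesis
    using that unfolding path_orders_def by blast
qed

section \<open>Isolated vertices and safe deletions\<close>

text \<open>All edges at a vertex lie in its own component, and a path with at least two vertices
  covers each of them by an edge.\<close>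

lemma ex_isolated_iff:
  assumes "path_orders M G"
  shows "(\<exists>v. isolated G v) \<longleftrightarrow> 1 \<in># M"
proof
  assume "\<exists>v. isolated G v"
  then obtain v where v: "v \<in> fst G" "\<forall>e\<in>snd G. v \<notin> e"
    unfolding isolated_def by blast
  obtain ps where ps: "linear_forest ps G" "mset (map length ps) = M"
    using assms by (auto simp: path_orders_def)
  then obtain xs where xs: "xs \<in> set ps" "v \<in> set xs"
    using v(1) by (auto simp: linear_forest_def)
  then have "\<forall>e\<in>path_edges xs. v \<notin> e"
    using ps(1) v(2) by (auto simp: linear_forest_def)
  then have "length xs = 1"
    using xs(2) path_edges_cover[of v xs] by auto
  then have "1 \<in> set (map length ps)"
    using xs(1) by (metis image_eqI set_map)
  then show "1 \<in># M"
    using ps(2) by (metis set_mset_mset)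
next
  assume "1 \<in># M"
  then obtain N where "M = add_mset 1 N"
    by (metis multi_member_split)
  then obtain ps xs qs where *: "linear_forest (ps @ xs # qs) G" "length xs = 1"
    using assms by (metis path_orders_add_msetE)
  then obtain v where v: "xs = [v]"
    by (auto simp: length_Suc_conv)
  with * have d: "v \<notin> set (concat (ps @ qs))"
    by (auto simp: linear_forest_def)
  have "v \<notin> e" if e: "e \<in> snd G" for e
  proof -
    obtain ys where "ys \<in> set (ps @ qs)" "e \<in> path_edges ys"
      using e * v by (auto simp: linear_forest_def)
    then show ?thesis
      using d path_edges_subset[of e ys] by auto
  qed
  moreover have "v \<in> fst G"
    using * v by (simp add: linear_forest_def)
  ultimately show "\<exists>v. isolated G v"
    unfolding isolated_def by blast
qed

lemma not_creates_isolated: "path_orders M H \<Longrightarrow> 1 \<notin># M \<Longrightarrow> \<not> creates_isolated G H"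
  unfolding creates_isolated_def using ex_isolated_iff by blast

text \<open>Cutting off a path of order 2 leaves \<open>k - 2 \<ge> 2\<close>, so no vertex becomes
  isolated. Left relies on this because mutual failures makes her moves available only while Right
  has a safe deletion.\<close>

lemma safe_deletion_Right_exists:
  assumes "path_orders M G" "1 \<notin># M" "k \<in># M" "k \<ge> 4"
  shows "\<exists>H. safe_deletion Right G H"
proof -
  have k: "2 + (k - 2) = k" "1 \<le> k - 2"
    using assms(4) by auto
  obtain N where N: "M = add_mset (2 + (k - 2)) N"
    using assms(3) k(1) by (metis multi_member_split)
  obtain e where e: "e \<in> snd G" "path_orders (add_mset 2 (add_mset (k - 2) N)) (delete_edge G e)"
    by (rule path_orders_edge_exists[OF assms(1)[unfolded N] _ k(2)]) auto
  have "\<not> creates_isolated G (delete_edge G e)"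
    using not_creates_isolated[OF e(2)] assms N by auto
  then show ?thesis
    using e(1) unfolding safe_deletion_def deletion.simps by blast
qed

section \<open>Winning conditions on multisets of orders\<close>

text \<open>The paths that Right can still cut safely: splitting an order of at most 3 into positive
  parts always yields a 1.\<close>

definition big :: "nat multiset \<Rightarrow> nat multiset" where
  "big M = {#k \<in># M. 4 \<le> k#}"

definition good_Left :: "nat multiset \<Rightarrow> bool" where
  "good_Left M \<longleftrightarrow> 1 \<notin># M \<and> big M \<noteq> {#} \<and> \<not> (3 \<notin># M \<and> big M = {#4, 4#})"

text \<open>Among positions without a 1, the exceptions are those from which a safe cut by Right
  breaks \<open>good_Left\<close>. If \<open>big M\<close> is empty, Right has no available move and
  the condition holds.\<close>

definition good_Right :: "nat multiset \<Rightarrow> bool" where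
  "good_Right M \<longleftrightarrow> 1 \<notin># M \<and> (\<forall>k\<le>6. big M \<noteq> {#k#}) \<and>
     (3 \<notin># M \<longrightarrow> big M \<notin> {{#8#}, {#4, 6#}, {#4, 4, 4#}})"

lemma big_add_mset: "big (add_mset k M) = (if 4 \<le> k then add_mset k (big M) else big M)"
  by (simp add: big_def)

lemma in_bigD: "k \<in># big M \<Longrightarrow> 4 \<le> k \<and> k \<in># M"
  by (simp add: big_def)

lemma good_Right_move:
  assumes "good_Right (add_mset (a + b) N)" "2 \<le> a" "2 \<le> b"
  shows "good_Left (add_mset a (add_mset b N))" (is "good_Left ?M")
proof -
  have N: "1 \<notin># N" "\<forall>k\<le>6. add_mset (a + b) (big N) \<noteq> {#k#}"
    "3 \<notin># N \<Longrightarrow> add_mset (a + b) (big N) \<notin> {{#8#}, {#4, 6#}, {#4, 4, 4#}}"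
    using assms by (auto simp: good_Right_def big_add_mset)
  have "big ?M \<noteq> {#}"
  proof
    assume "big ?M = {#}"
    \<comment> \<open>Both parts are at most 3, so their sum would be the only large path, of order
      at most 6.\<close>
    then have "a + b \<le> 6" "big N = {#}"
      by (auto simp: big_add_mset split: if_splits)
    then show False using N(2) by metis
  qed
  moreover have False if 3: "3 \<notin># ?M" and eq: "big ?M = {#4, 4#}"
  proof -
    have four: "x = 4" if "x \<in># big ?M" for x
      using that unfolding eq by simp
    have "a \<noteq> 3" "b \<noteq> 3"
      using 3 by auto
    have "4 \<le> a \<Longrightarrow> a = 4" "4 \<le> b \<Longrightarrow> b = 4"
      by (rule four, simp add: big_add_mset)+
    then have "a = 2 \<or> a = 4" "b = 2 \<or> b = 4"
      using \<open>a \<noteq> 3\<close> \<open>b \<noteq> 3\<close> assms(2,3) by linarith+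
    \<comment> \<open>Gluing the parts back turns {4, 4} into an exception: 2 + 2 gives {4, 4, 4}, 2
      + 4 gives {4, 6} and 4 + 4 gives {8}.\<close>
    then have "add_mset (a + b) (big N) \<in> {{#8#}, {#4, 6#}, {#4, 4, 4#}}"
    proof (elim disjE)
      assume "a = 2" "b = 2"
      with eq have "big N = {#4, 4#}" by (simp add: big_add_mset)
      then show ?thesis using \<open>a = 2\<close> \<open>b = 2\<close> by simp
    next
      assume "a = 2" "b = 4"
      with eq have "big N = {#4#}" by (simp add: big_add_mset)
      then show ?thesis using \<open>a = 2\<close> \<open>b = 4\<close> by (simp add: add_mset_commute)
    next
      assume "a = 4" "b = 2"
      with eq have "big N = {#4#}" by (simp add: big_add_mset)
      then show ?thesis using \<open>a = 4\<close> \<open>b = 2\<close> by (simp add: add_mset_commute)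
    next
      assume "a = 4" "b = 4"
      with eq have "big N = {#}" by (simp add: big_add_mset)
      then show ?thesis using \<open>a = 4\<close> \<open>b = 4\<close> by simp
    qed
    then show False
      using 3 N(3) by simp
  qed
  ultimately show ?thesis
    using N(1) assms by (auto simp: good_Left_def)
qed

text \<open>Shortening a large path by one vertex (\<open>a = 0\<close>) is the default; where it
  may lead to an exception of \<open>good_Right\<close>, a large path is split or a 3 is shortened
  instead.\<close>

lemma good_Left_move:
  assumes "good_Left M"
  obtains a b N where "M = add_mset (a + b + 1) N" "good_Right (add_mset a (add_mset b N))"
proof -
  note move' = that
  have move: thesis if "M = add_mset k N" "k = a + b + 1" "good_Right (add_mset a (add_mset b N))"
    for k a b N
    using move'[of a b N] that by simp
  have ne: "big M \<noteq> {#}" and M1: "1 \<notin># M"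
    using assms by (auto simp: good_Left_def)
  \<comment> \<open>With two large paths other than {4, 4} the longest is attacked, with three or
    more the shortest.\<close>
  define k where "k = Max_mset (big M)"
  define l where "l = Min_mset (big M)"
  have "k \<in># big M" "l \<in># big M" and max: "\<forall>j\<in>#big M. j \<le> k" and min: "\<forall>j\<in>#big M. l \<le> j"
    using ne by (auto simp: k_def l_def)
  then obtain N N' where N: "M = add_mset k N" and N': "M = add_mset l N'" and "4 \<le> k" "4 \<le> l"
    by (metis in_bigD multi_member_split)
  then have bN: "big M = add_mset k (big N)" and bN': "big M = add_mset l (big N')"
    by (metis big_add_mset)+
  have [simp]: "Suc 0 \<notin># N" "Suc 0 \<notin># N'"
    using M1 by (metis N N' One_nat_def union_iff add_mset_add_single)+
  \<comment> \<open>One, two, or at least three large paths; the third case is phrased by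
    \<open>N'\<close> since there the shortest path is attacked.\<close>
  consider "big N = {#}" | j where "big N = {#j#}" | i j R where "big N' = {#i, j#} + R"
  proof (cases "big N'")
    case empty
    then show ?thesis using bN bN' that(1) by auto
  next
    case (add i S)
    then show ?thesis
    proof (cases S)
      case empty
      then have "size (big N) = 1"
        using bN bN' add by (metis add_mset_eq_single size_add_mset size_single Suc_inject)
      then show ?thesis using that(2) size_1_singleton_mset by blast
    qed (use that(3) add in auto)
  qed
  then show thesis
  proof cases
    case single: 1
    \<comment> \<open>Up to order 7 the chosen parts are at most 3, so Right cannot move. Order 9 is
      split into 4 and 4, since shortening may leave {8}; any other order is shortened to at least
      7, never to 8.\<close>
    consider "k = 4" | "k = 5" | "k = 6" | "k = 7" | "k = 9" | "k \<ge> 8" "k \<noteq> 9"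
      using \<open>4 \<le> k\<close> by linarith
    then show thesis
    proof cases
      case 1
      then show ?thesis
        by (intro move[OF N, of 0 3]) (use single in \<open>auto simp: good_Right_def big_add_mset\<close>)
    next
      case 2
      then show ?thesis
        by (intro move[OF N, of 2 2]) (use single in \<open>auto simp: good_Right_def big_add_mset\<close>)
    next
      case 3
      then show ?thesis
        by (intro move[OF N, of 2 3]) (use single in \<open>auto simp: good_Right_def big_add_mset\<close>)
    next
      case 4
      then show ?thesis
        by (intro move[OF N, of 3 3]) (use single in \<open>auto simp: good_Right_def big_add_mset\<close>)
    next
      case 5
      then show ?thesis
        by (intro move[OF N, of 4 4]) (use single in \<open>auto simp: good_Right_def big_add_mset\<close>)
    next
      case 6
      then show ?thesis
        by (intro move[OF N, of 0 "k - 1"]) (use single in \<open>auto simp: good_Right_def big_add_mset\<close>)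
    qed
  next
    case (2 j)
    have j: "4 \<le> j" "j \<le> k"
      using 2 max bN in_bigD[of j N] by auto
    \<comment> \<open>Shortening 7 beside 4 may leave {4, 6}, so 7 is split into 2 and 4. Shortening
      5 beside 6 cannot occur, as \<open>j \<le> k\<close>.\<close>
    consider "k = 4" | "k = 7" "j = 4" | "k \<ge> 5" "\<not> (k = 7 \<and> j = 4)"
      using \<open>4 \<le> k\<close> by linarith
    then show thesis
    proof cases
      case 1
      \<comment> \<open>Left uses a spare move.\<close>
      then have "big M = {#4, 4#}" using j bN 2 by auto
      then have "3 \<in># M" using assms by (auto simp: good_Left_def)
      then obtain L where L: "M = add_mset 3 L" by (auto dest: multi_member_split)
      then have "big L = {#4, 4#}" "Suc 0 \<notin># L"
        using \<open>big M = {#4, 4#}\<close> M1 by (auto simp: big_add_mset)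
      then show ?thesis by (intro move[OF L, of 0 2]) (auto simp: good_Right_def big_add_mset)
    next
      case b: 2
      show ?thesis
        by (rule move[OF N, of 2 4]) (use b 2 in \<open>auto simp: good_Right_def big_add_mset\<close>)
    next
      case 3
      show ?thesis
        by (rule move[OF N, of 0 "k - 1"])
          (use 3 2 j in \<open>auto simp: good_Right_def big_add_mset add_eq_conv_ex\<close>)
    qed
  next
    case (3 i j R)
    \<comment> \<open>Shortening a shortest path either creates a 3 or leaves three long paths not all of order 4.\<close>
    have ij: "l \<le> i" "l \<le> j"
      using 3 min bN' by auto
    show thesis
      by (rule move[OF N', of 0 "l - 1"])
        (use \<open>4 \<le> l\<close> ij 3 in \<open>auto simp: good_Right_def big_add_mset add_eq_conv_ex\<close>)
  qed
qed

section \<open>Winning play on unions of paths\<close>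

text \<open>Right's move keeps the number of vertices, so \<open>IH\<close> is asked only for
  multisets of equal sum; this makes the lemma usable inside an induction on that number.\<close>

lemma wins_paths_Right:
  assumes "path_orders M G" "good_Right M"
    and IH: "\<And>M' (H :: 'a graph). path_orders M' H \<Longrightarrow> good_Left M' \<Longrightarrow> sum_mset M' = sum_mset M \<Longrightarrow>
      wins Left Left H"
  shows "wins Left Right (G :: 'a graph)"
proof -
  have "wins Left Left H" if H: "available_move Right G H" for H
  proof -
    obtain e where e: "e \<in> snd G" "H = delete_edge G e" "\<not> creates_isolated G H"
      using H unfolding available_move_def safe_deletion_def deletion.simps by blast
    then obtain a b N where N: "M = add_mset (a + b) N" "a \<ge> 1" "b \<ge> 1"
      "path_orders (add_mset a (add_mset b N)) H"
      using path_orders_delete_edge[OF assms(1)] by metis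
    have "1 \<notin># M"
      using assms by (simp add: good_Right_def)
    \<comment> \<open>\<open>G\<close> has no isolated vertex, so any isolated vertex of
      \<open>H\<close> would be newly created.\<close>
    then have "1 \<notin># add_mset a (add_mset b N)"
      using e(3) ex_isolated_iff[OF assms(1)] ex_isolated_iff[OF N(4)]
      unfolding creates_isolated_def by blast
    then have "2 \<le> a" "2 \<le> b"
      using N by auto
    then show ?thesis
      using IH[OF N(4)] good_Right_move assms(2) N(1) by auto
  qed
  then show ?thesis
    using other_turn[of Left G] by simp
qed

text \<open>Induction on the number of vertices: Left's deletion lowers it by one and Right's reply
  preserves it.\<close>

lemma wins_paths_Left:
  "path_orders M G \<Longrightarrow> good_Left M \<Longrightarrow> wins Left Left (G :: 'a graph)"
proof (induction "sum_mset M" arbitrary: M G rule: less_induct)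
  case less
  obtain a b N where N: "M = add_mset (a + b + 1) N"
    and good: "good_Right (add_mset a (add_mset b N))" (is "good_Right ?M'")
    using good_Left_move[OF less.prems(2)] .
  obtain v where v: "v \<in> fst G" "path_orders ?M' (delete_vertex G v)"
    using path_orders_delete_vertex less.prems(1) N by metis
  have wins: "wins Left Right (delete_vertex G v)"
    by (rule wins_paths_Right[OF v(2) good], rule less.hyps) (simp_all add: N)
  have "1 \<notin># ?M'"
    using good by (simp add: good_Right_def)
  then have "\<not> creates_isolated G (delete_vertex G v)"
    by (rule not_creates_isolated[OF v(2)])
  \<comment> \<open>A large path gives Right a safe deletion in \<open>G\<close>, which makes Left's
    deletion available.\<close>
  moreover obtain k where "k \<in># M" "k \<ge> 4" "1 \<notin># M"
    using less.prems(2) by (auto simp: good_Left_def dest: in_bigD multiset_nonemptyE)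
  then have "\<exists>K. safe_deletion Right G K"
    using safe_deletion_Right_exists less.prems(1) by metis
  ultimately have "available_move Left G (delete_vertex G v)"
    using v(1) unfolding available_move_def safe_deletion_def deletion.simps opponent.simps by blast
  then show ?case
    using own_turn[of Left G] wins by simp
qed

section \<open>Breaking the cycle\<close>

lemma path_edges_upt: "path_edges [a..<b] = {{j, Suc j} | j. a \<le> j \<and> Suc j < b}"
proof (induction b)
  case (Suc b)
  show ?case
  proof (cases "a < b")
    case True
    then have "path_edges [a..<Suc b] = insert {b - 1, b} (path_edges [a..<b])"
      by (auto simp: path_edges_append)
    also have "\<dots> = {{j, Suc j} | j. a \<le> j \<and> Suc j < Suc b}"
      unfolding Suc using True by (auto simp: less_Suc_eq intro: exI[of _ "b - 1"])
    finally show ?thesis .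
  qed auto
qed auto

lemma path_orders_single:
  "distinct xs \<Longrightarrow> G = (set xs, path_edges xs) \<Longrightarrow> path_orders {#length xs#} G"
  unfolding path_orders_def linear_forest_def by (intro exI[of _ "[xs]"]) auto

lemma cycle_vertices: "fst (cycle_graph n) = {..<n}"
  by (simp add: cycle_graph_def)

text \<open>Separates the closing edge from the consecutive ones, which removes \<open>mod\<close>
  and matches \<open>path_edges_upt\<close>.\<close>

lemma cycle_edges:
  assumes "n \<ge> 1"
  shows "snd (cycle_graph n) = insert {n - 1, 0} {{j, Suc j} | j. Suc j < n}"
proof -
  have "{{i, Suc i mod n} | i. i < n} = (\<lambda>i. {i, Suc i mod n}) ` insert (n - 1) {i. Suc i < n}"
  proof (intro equalityI subsetI)
    fix e assume "e \<in> {{i, Suc i mod n} | i. i < n}"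
    then obtain i where "e = {i, Suc i mod n}" "i < n" by blast
    then show "e \<in> (\<lambda>i. {i, Suc i mod n}) ` insert (n - 1) {i. Suc i < n}"
      by (cases "Suc i = n") auto
  qed (use assms in auto)
  then show ?thesis
    using assms by (auto simp: cycle_graph_def)
qed

text \<open>Left chooses her first vertex, so one vertex is enough; \<open>n - 1\<close> leaves an
  initial interval in its natural order.\<close>

lemma cycle_delete_vertex:
  assumes "n \<ge> 3"
  shows "path_orders {#n - 1#} (delete_vertex (cycle_graph n) (n - 1))"
proof -
  have "{..<n} - {n - 1} = set [0..<n - 1]"
    using assms by auto
  moreover have "{e \<in> snd (cycle_graph n). n - 1 \<notin> e} = path_edges [0..<n - 1]"
    using assms by (auto simp: cycle_edges path_edges_upt)
  ultimately have "delete_vertex (cycle_graph n) (n - 1) = (set [0..<n - 1], path_edges [0..<n - 1])"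
    by (simp add: delete_vertex_def cycle_graph_def)
  then show ?thesis
    using path_orders_single[of "[0..<n - 1]"] by auto
qed

lemma cycle_delete_edge:
  assumes "n \<ge> 3" "e \<in> snd (cycle_graph n)"
  shows "path_orders {#n#} (delete_edge (cycle_graph n) e)"
proof (cases "e = {n - 1, 0}")
  case True
  have "snd (cycle_graph n) - {e} = path_edges [0..<n]"
    using assms(1) True by (auto simp: cycle_edges path_edges_upt doubleton_eq_iff)
  then have "delete_edge (cycle_graph n) e = (set [0..<n], path_edges [0..<n])"
    by (simp add: delete_edge_def cycle_vertices atLeast0LessThan)
  then show ?thesis
    using path_orders_single[of "[0..<n]"] by auto
next
  case False
  then obtain i where i: "e = {i, Suc i}" "Suc i < n"
    using assms by (auto simp: cycle_edges)
  \<comment> \<open>The path starts just after the cut, crosses the closing edge from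
    \<open>n - 1\<close> to 0 and ends at \<open>i\<close>.\<close>
  let ?xs = "[Suc i..<n] @ [0..<Suc i]"
  have "path_edges ?xs = path_edges [Suc i..<n] \<union> path_edges [0..<Suc i] \<union> {{n - 1, 0}}"
    using i by (simp add: path_edges_append del: upt_Suc)
  also have "\<dots> = snd (cycle_graph n) - {e}"
  proof -
    have "{{j, Suc j} | j. Suc j < n} - {e} =
        {{j, Suc j} | j. Suc i \<le> j \<and> Suc j < n} \<union> {{j, Suc j} | j. Suc j < Suc i}"
      using i by (auto simp: doubleton_eq_iff not_le)
    moreover have "snd (cycle_graph n) - {e} = insert {n - 1, 0} ({{j, Suc j} | j. Suc j < n} - {e})"
      using assms False by (simp add: cycle_edges insert_Diff_if)
    ultimately show ?thesis
      by (simp add: path_edges_upt del: upt_Suc)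
  qed
  finally have "path_edges ?xs = snd (cycle_graph n) - {e}" .
  moreover have "set ?xs = {..<n}"
    using i by auto
  ultimately have "delete_edge (cycle_graph n) e = (set ?xs, path_edges ?xs)"
    by (simp add: delete_edge_def cycle_vertices del: upt_Suc)
  then show ?thesis
    using path_orders_single[of ?xs] i by (auto simp del: upt_Suc)
qed

theorem theorem3p19:
  fixes n :: nat and first :: player
  assumes "n \<ge> 10"
  shows "wins Left first (cycle_graph n)"
proof (cases first)
  case Left
  let ?H = "delete_vertex (cycle_graph n) (n - 1)"
  \<comment> \<open>A witness that Right could also move, as availability of Left's deletion
    demands.\<close>
  let ?K = "delete_edge (cycle_graph n) {n - 1, 0}"
  have H: "path_orders {#n - 1#} ?H"
    using assms by (intro cycle_delete_vertex) auto
  have e: "{n - 1, 0} \<in> snd (cycle_graph n)"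
    using assms by (simp add: cycle_edges)
  then have K: "path_orders {#n#} ?K"
    using assms by (intro cycle_delete_edge) auto
  have "safe_deletion Left (cycle_graph n) ?H"
    using assms not_creates_isolated[OF H]
    by (auto simp: safe_deletion_def cycle_graph_def intro!: bexI[of _ "n - 1"])
  moreover have "safe_deletion Right (cycle_graph n) ?K"
    using assms e not_creates_isolated[OF K] by (auto simp: safe_deletion_def)
  ultimately have "available_move Left (cycle_graph n) ?H"
    unfolding available_move_def opponent.simps by blast
  \<comment> \<open>The bound \<open>n \<ge> 10\<close> enters here: an order of at least 9 avoids 8
    as well as all orders up to 6.\<close>
  moreover have "good_Right {#n - 1#}"
    using assms by (auto simp: good_Right_def big_def)
  then have "wins Left Right ?H"
    using wins_paths_Right[OF H] wins_paths_Left by blast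
  ultimately show ?thesis
    using own_turn[of Left] Left by simp
next
  case Right
  have "wins Left Left H" if H: "available_move Right (cycle_graph n) H" for H
  proof -
    obtain e where "e \<in> snd (cycle_graph n)" "H = delete_edge (cycle_graph n) e"
      using H unfolding available_move_def safe_deletion_def deletion.simps by blast
    then have "path_orders {#n#} H"
      using assms cycle_delete_edge by auto
    moreover have "good_Left {#n#}"
      using assms by (auto simp: good_Left_def big_def)
    ultimately show ?thesis
      by (rule wins_paths_Left)
  qed
  then show ?thesis
    using other_turn[of Left "cycle_graph n"] Right unfolding opponent.simps by blast
qed

end
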